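(* There exists a randomized streaming algorithm for (not necessarily monotone) maximum submodular matching (\textsc{MSM}) which runs in time linear in the number of edges $|E|$ (times the time of a value-oracle evaluation of $f$) and is $(4+2\sqrt{3})\approx 7.464$ approximate, i.e., it outputs a matching $M$ with $\mathbb{E}[f(M)]\geq \frac{1}{4+2\sqrt{3}}\, f(OPT)$, where $OPT$ is a maximum-value matching.
   Context: An instance of \textsc{MSM} consists of an $n$-vertex graph $G=(V,E)$ and a non-negative submodular set function $f:2^E\to\mathbb{R}_{\geq 0}$ (submodular: $f(S\cup\{e\})-f(S)\geq f(T\cup\{e\})-f(T)$ for $S\subseteq T\subseteq E$, $e\notin T$), accessed through a value oracle; $f$ need not be monotone. Feasible solutions are matchings of $G$, and the goal is to maximize $f$. In the streaming model the edges of $E$ arrive one at a time in an arbitrary order, and the algorithm must output a matching at the end of the stream using space $\tilde O(M_{\max})$, where $M_{\max}$ is the maximum size of a matching in $G$; the algorithm may query the oracle only on subsets currently stored in memory. It is assumed that $f_{\max}/f_{\min}=n^{O(1)}$, where $f_{\max}=\max_{e\in E}f(\{e\})$ and $f_{\min}$ is the minimum nonzero value of $f(S\cup\{e\})-f(S)$ over $e\in E$, $S\subseteq E$. An algorithm is $\alpha$-approximate if its output $M$ satisfies $\mathbb{E}[f(M)]\ge f(OPT)/\alpha$. *)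

theory Defs
  imports "HOL-Probability.Probability"
begin

section \<open>Graphs, matchings and submodular functions\<close>

type_synonym edge = "nat set"

definition simple_graph :: "nat set \<Rightarrow> edge set \<Rightarrow> bool" where
  "simple_graph V E \<longleftrightarrow> finite V \<and> (\<forall>e\<in>E. e \<subseteq> V \<and> card e = 2)"

definition matching :: "edge set \<Rightarrow> edge set \<Rightarrow> bool" where
  "matching E M \<longleftrightarrow> M \<subseteq> E \<and> disjoint M"

definition M_max :: "edge set \<Rightarrow> nat" where
  "M_max E = Max (card ` {M. matching E M})"

definition nonneg_on :: "edge set \<Rightarrow> (edge set \<Rightarrow> real) \<Rightarrow> bool" where
  "nonneg_on E f \<longleftrightarrow> (\<forall>S\<subseteq>E. 0 \<le> f S)"

definition submodular_on :: "edge set \<Rightarrow> (edge set \<Rightarrow> real) \<Rightarrow> bool" where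
  "submodular_on E f \<longleftrightarrow>
     (\<forall>S T e. S \<subseteq> T \<and> T \<subseteq> E \<and> e \<in> E \<and> e \<notin> T \<longrightarrow>
        f (S \<union> {e}) - f S \<ge> f (T \<union> {e}) - f T)"

definition msm_instance :: "nat set \<Rightarrow> edge set \<Rightarrow> (edge set \<Rightarrow> real) \<Rightarrow> bool" where
  "msm_instance V E f \<longleftrightarrow> simple_graph V E \<and> nonneg_on E f \<and> submodular_on E f"

definition f_max :: "edge set \<Rightarrow> (edge set \<Rightarrow> real) \<Rightarrow> real" where
  "f_max E f = Max ((\<lambda>e. f {e}) ` E)"

text \<open>Marginals of a non-monotone function may be negative, in which case a minimum over all
  nonzero marginals would be negative and its ratio to the maximum singleton value meaningless.
  The minimum is therefore taken over the positive marginals. For monotone functions this is the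
  minimum nonzero marginal, and in general the resulting bound on the ratio is implied by the one
  for the minimum nonzero absolute value.\<close>

definition positive_marginals :: "edge set \<Rightarrow> (edge set \<Rightarrow> real) \<Rightarrow> real set" where
  "positive_marginals E f =
     {m. 0 < m \<and> (\<exists>e\<in>E. \<exists>S\<subseteq>E. m = f (S \<union> {e}) - f S)}"

definition f_min :: "edge set \<Rightarrow> (edge set \<Rightarrow> real) \<Rightarrow> real" where
  "f_min E f = Min (positive_marginals E f)"

text \<open>The guard covers the case in which there is no positive marginal and the minimum is
  undefined.\<close>

definition ratio_bounded :: "nat \<Rightarrow> nat set \<Rightarrow> edge set \<Rightarrow> (edge set \<Rightarrow> real) \<Rightarrow> bool" where
  "ratio_bounded d V E f \<longleftrightarrow>
     (positive_marginals E f \<noteq> {} \<longrightarrow> f_max E f / f_min E f \<le> real (card V) ^ d)"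

section \<open>Randomized one-pass streaming programs with a value oracle\<close>

text \<open>A program is a finite instruction list for a real-number random access machine that reads
  its edges once, in stream order. Apart from oracle evaluations, every instruction is a
  constant-time operation on such a machine. The machine has real registers, edge registers,
  real-valued dictionaries keyed by vertices, and stacks of edges; all of these are named by
  natural numbers that occur literally in the program, so a program uses only finitely many.

  Edges and vertices are opaque: an edge enters the memory only through \<open>Read\<close>, it can
  afterwards only be copied, and vertices serve only as dictionary keys. Hence they cannot be
  packed into numbers to evade the space bound. An oracle query names a stack, so that the
  queried set always consists of edges stored in memory at that moment. Numeric constants are
  integers; a program therefore has no access to arbitrary real numbers.

  A program knows neither the number of vertices nor the number of edges.\<close>

datatype instr =
    LoadInt nat int          \<comment> \<open>\<open>LoadInt r i\<close>: register \<open>r\<close> becomes \<open>i\<close>\<close>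
  | Add nat nat nat          \<comment> \<open>\<open>Add r x y\<close>: register \<open>r\<close> becomes \<open>x + y\<close>\<close>
  | Sub nat nat nat
  | Mul nat nat nat
  | Div nat nat nat
  | Sqrt nat nat
  | Flip nat nat             \<comment> \<open>\<open>Flip r x\<close>: \<open>r\<close> becomes 1 with probability \<open>x\<close> (clipped to [0,1]), else 0\<close>
  | JumpLe nat nat nat       \<comment> \<open>\<open>JumpLe x y l\<close>: jump to \<open>l\<close> if \<open>x \<le> y\<close>\<close>
  | Get nat nat nat bool     \<comment> \<open>\<open>Get r a e b\<close>: \<open>r\<close> becomes the entry of dictionary \<open>a\<close> at endpoint \<open>b\<close> of \<open>e\<close>\<close>
  | Put nat nat bool nat     \<comment> \<open>\<open>Put a e b x\<close>: the entry of \<open>a\<close> at endpoint \<open>b\<close> of \<open>e\<close> becomes \<open>x\<close>\<close>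
  | Push nat nat             \<comment> \<open>\<open>Push s e\<close>\<close>
  | Pop nat nat nat          \<comment> \<open>\<open>Pop s e l\<close>: pop from \<open>s\<close> into \<open>e\<close>; jump to \<open>l\<close> if \<open>s\<close> is empty\<close>
  | Query nat nat            \<comment> \<open>\<open>Query r s\<close>: \<open>r\<close> becomes the value of the oracle on the edges in \<open>s\<close>\<close>
  | Read nat nat             \<comment> \<open>\<open>Read e l\<close>: next stream edge into \<open>e\<close>; jump to \<open>l\<close> at the end of the stream\<close>

type_synonym program = "instr list"

record config =
  pc     :: nat
  regs   :: "nat \<Rightarrow> real"
  eregs  :: "nat \<Rightarrow> edge option"
  dicts  :: "nat \<Rightarrow> nat \<Rightarrow> real"
  stacks :: "nat \<Rightarrow> edge list"
  stream :: "edge list"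
  clock  :: nat

definition init_config :: "edge list \<Rightarrow> config" where
  "init_config es = \<lparr>pc = 0, regs = (\<lambda>_. 0), eregs = (\<lambda>_. None), dicts = (\<lambda>_ _. 0),
     stacks = (\<lambda>_. []), stream = es, clock = 0\<rparr>"

definition endpoint :: "bool \<Rightarrow> edge \<Rightarrow> nat" where
  "endpoint b e = (if b then Max e else Min e)"

definition set_reg :: "nat \<Rightarrow> real \<Rightarrow> config \<Rightarrow> config" where
  "set_reg r x \<sigma> = \<sigma>\<lparr>regs := (regs \<sigma>)(r := x)\<rparr>"

definition set_ereg :: "nat \<Rightarrow> edge \<Rightarrow> config \<Rightarrow> config" where
  "set_ereg r e \<sigma> = \<sigma>\<lparr>eregs := (eregs \<sigma>)(r := Some e)\<rparr>"

definition set_stack :: "nat \<Rightarrow> edge list \<Rightarrow> config \<Rightarrow> config" where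
  "set_stack s es \<sigma> = \<sigma>\<lparr>stacks := (stacks \<sigma>)(s := es)\<rparr>"

definition set_dict :: "nat \<Rightarrow> nat \<Rightarrow> real \<Rightarrow> config \<Rightarrow> config" where
  "set_dict a v x \<sigma> = \<sigma>\<lparr>dicts := (dicts \<sigma>)(a := (dicts \<sigma> a)(v := x))\<rparr>"

text \<open>In \<open>exec\<close> the program counter has already been advanced, so jumps overwrite it.\<close>

fun exec :: "(edge set \<Rightarrow> real) \<Rightarrow> instr \<Rightarrow> config \<Rightarrow> config pmf" where
  "exec f (LoadInt r i) \<sigma> = return_pmf (set_reg r (of_int i) \<sigma>)"
| "exec f (Add r x y) \<sigma> = return_pmf (set_reg r (regs \<sigma> x + regs \<sigma> y) \<sigma>)"
| "exec f (Sub r x y) \<sigma> = return_pmf (set_reg r (regs \<sigma> x - regs \<sigma> y) \<sigma>)"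
| "exec f (Mul r x y) \<sigma> = return_pmf (set_reg r (regs \<sigma> x * regs \<sigma> y) \<sigma>)"
| "exec f (Div r x y) \<sigma> = return_pmf (set_reg r (regs \<sigma> x / regs \<sigma> y) \<sigma>)"
| "exec f (Sqrt r x) \<sigma> = return_pmf (set_reg r (sqrt (regs \<sigma> x)) \<sigma>)"
| "exec f (Flip r x) \<sigma> =
     map_pmf (\<lambda>b. set_reg r (if b then 1 else 0) \<sigma>) (bernoulli_pmf (regs \<sigma> x))"
| "exec f (JumpLe x y l) \<sigma> =
     return_pmf (if regs \<sigma> x \<le> regs \<sigma> y then \<sigma>\<lparr>pc := l\<rparr> else \<sigma>)"
| "exec f (Get r a e b) \<sigma> = return_pmf (case eregs \<sigma> e of
       None \<Rightarrow> \<sigma> | Some d \<Rightarrow> set_reg r (dicts \<sigma> a (endpoint b d)) \<sigma>)"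
| "exec f (Put a e b x) \<sigma> = return_pmf (case eregs \<sigma> e of
       None \<Rightarrow> \<sigma> | Some d \<Rightarrow> set_dict a (endpoint b d) (regs \<sigma> x) \<sigma>)"
| "exec f (Push s e) \<sigma> = return_pmf (case eregs \<sigma> e of
       None \<Rightarrow> \<sigma> | Some d \<Rightarrow> set_stack s (d # stacks \<sigma> s) \<sigma>)"
| "exec f (Pop s e l) \<sigma> = return_pmf (case stacks \<sigma> s of
       [] \<Rightarrow> \<sigma>\<lparr>pc := l\<rparr> | d # ds \<Rightarrow> set_stack s ds (set_ereg e d \<sigma>))"
| "exec f (Query r s) \<sigma> = return_pmf (set_reg r (f (set (stacks \<sigma> s))) \<sigma>)"
| "exec f (Read e l) \<sigma> = return_pmf (case stream \<sigma> of
       [] \<Rightarrow> \<sigma>\<lparr>pc := l\<rparr> | d # ds \<Rightarrow> set_ereg e d (\<sigma>\<lparr>stream := ds\<rparr>))"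

text \<open>\<open>\<tau>\<close> is the time of one oracle evaluation.\<close>

definition cost :: "nat \<Rightarrow> instr \<Rightarrow> nat" where
  "cost \<tau> i = (case i of Query _ _ \<Rightarrow> \<tau> | _ \<Rightarrow> 1)"

definition halted :: "program \<Rightarrow> config \<Rightarrow> bool" where
  "halted P \<sigma> \<longleftrightarrow> length P \<le> pc \<sigma>"

definition step :: "program \<Rightarrow> (edge set \<Rightarrow> real) \<Rightarrow> nat \<Rightarrow> config \<Rightarrow> config pmf" where
  "step P f \<tau> \<sigma> =
     (if halted P \<sigma> then return_pmf \<sigma>
      else let i = P ! pc \<sigma>
           in exec f i (\<sigma>\<lparr>pc := Suc (pc \<sigma>), clock := clock \<sigma> + cost \<tau> i\<rparr>))"

primrec run :: "program \<Rightarrow> (edge set \<Rightarrow> real) \<Rightarrow> nat \<Rightarrow> edge list \<Rightarrow> nat \<Rightarrow> config pmf" where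
  "run P f \<tau> es 0 = return_pmf (init_config es)"
| "run P f \<tau> es (Suc t) = bind_pmf (run P f \<tau> es t) (step P f \<tau>)"

text \<open>The space is counted in words, a word holding a real number or an edge. Registers in their
  initial state and dictionary entries equal to 0 take no space. The unread part of the stream is
  not part of the memory. All the sets below are finite in every configuration reachable from an
  initial one.\<close>

definition space_used :: "config \<Rightarrow> nat" where
  "space_used \<sigma> =
     card {r. regs \<sigma> r \<noteq> 0} + card {r. eregs \<sigma> r \<noteq> None} +
     card {(a, v). dicts \<sigma> a v \<noteq> 0} +
     (\<Sum>s | stacks \<sigma> s \<noteq> []. length (stacks \<sigma> s))"

text \<open>The output is the content of stack 0.\<close>

definition result :: "config \<Rightarrow> edge set" where
  "result \<sigma> = set (stacks \<sigma> 0)"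

end

theory Submission
  imports Defs
begin

text \<open>The algorithm maintains a stack \<open>S\<close> of edges and vertex potentials. An arriving edge is
  discarded unless its marginal value with respect to \<open>S\<close> exceeds \<open>C\<close> times the sum of the
  potentials of its endpoints; otherwise it is pushed with probability \<open>q\<close>, and its residual (the
  marginal minus that sum) is added to both potentials. Finally the stack is unwound greedily into
  a matching \<open>M\<close>.

  Let \<open>W\<close> be the sum of the residuals, so that the potentials sum to \<open>2 W\<close>. Then
  \<open>f M \<ge> f {} + W\<close> and \<open>f S \<le> f {} + C / (C - 1) * W\<close> hold on every run. Since
  \<open>2 q C = 1 - q\<close>, the expected marginal of any edge with respect to the final stack is at most \<open>C\<close>
  times the expected potential of its endpoints, whence
  \<open>E f (S \<union> OPT) \<le> E f S + 2 C * E W\<close>. As no edge is pushed with probability above \<open>q\<close>, also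
  \<open>E f (S \<union> OPT) \<ge> (1 - q) * f OPT\<close>. The resulting ratio \<open>(4 C\<^sup>2 - 1) / (2 C - 2)\<close> is
  minimised by \<open>C = 1 + sqrt 3 / 2\<close>.

  Each push at a vertex multiplies its potential by at least \<open>C\<close>, so that under the ratio
  assumption the stack has logarithmic degree, and its size is bounded through the maximal matching
  \<open>M\<close> of the stack.\<close>

section \<open>The sampled primal-dual algorithm\<close>

definition C :: real where "C = sqrt 3 / 2 + 1"

text \<open>This is \<open>1 / (2 * C + 1)\<close>, the solution of
  \<open>coin_balance\<close>.\<close>

definition q :: real where "q = 1 / (3 + sqrt 3)"

lemma C_gt_1: "1 < C"
  by (simp add: C_def)

lemma q_bounds: "0 < q" "q < 1 / 2"
  using real_sqrt_ge_zero[of 3] by (auto simp: q_def field_simps add_pos_nonneg)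

lemma coin_balance: "2 * q * C = 1 - q"
proof -
  have "3 + sqrt 3 \<noteq> (0::real)"
    using real_sqrt_ge_zero[of 3] by linarith
  then show ?thesis
    by (simp add: q_def C_def field_simps)
qed

text \<open>The left side is the loss factor of the charging argument, and \<open>1 - q\<close> is
  the share of \<open>f OPT\<close> that survives the sampling; their quotient is the approximation
  ratio.\<close>

lemma ratio_identity: "2 * C + C / (C - 1) = (4 + 2 * sqrt 3) * (1 - q)"
proof -
  have "3 + sqrt 3 \<noteq> (0::real)"
    using real_sqrt_ge_zero[of 3] by linarith
  then show ?thesis
    by (simp add: q_def C_def field_simps)
qed

section \<open>Potentials, the sampling pass and the greedy unwinding\<close>

definition marg :: "(edge set \<Rightarrow> real) \<Rightarrow> edge \<Rightarrow> edge set \<Rightarrow> real" where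
  "marg f e X = f (insert e X) - f X"

lemma marg_mem [simp]: "e \<in> X \<Longrightarrow> marg f e X = 0"
  by (simp add: marg_def insert_absorb)

text \<open>The head of the list is the edge pushed last. The potentials are thus a function of the
  stack alone, and the stack is the whole state of the algorithm.\<close>

primrec phi :: "(edge set \<Rightarrow> real) \<Rightarrow> edge list \<Rightarrow> nat \<Rightarrow> real" where
  "phi f [] = (\<lambda>v. 0)"
| "phi f (e # S) =
     (\<lambda>v. phi f S v + (if v \<in> e then marg f e (set S) - (\<Sum>u\<in>e. phi f S u) else 0))"

definition load :: "(edge set \<Rightarrow> real) \<Rightarrow> edge list \<Rightarrow> edge \<Rightarrow> real" where
  "load f S e = (\<Sum>u\<in>e. phi f S u)"

definition resid :: "(edge set \<Rightarrow> real) \<Rightarrow> edge list \<Rightarrow> edge \<Rightarrow> real" where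
  "resid f S e = marg f e (set S) - load f S e"

lemma phi_Cons: "phi f (e # S) v = phi f S v + (if v \<in> e then resid f S e else 0)"
  by (simp add: resid_def load_def)

declare phi.simps(2) [simp del]

lemma phi_supp: "phi f S v \<noteq> 0 \<Longrightarrow> v \<in> \<Union> (set S)"
  by (induction S) (auto simp: phi_Cons split: if_splits)

text \<open>This is the invariant of all stacks that the pass can produce. It isolates the
  deterministic part of the analysis, which then needs no probability.\<close>

primrec good :: "(edge set \<Rightarrow> real) \<Rightarrow> edge list \<Rightarrow> bool" where
  "good f [] \<longleftrightarrow> True"
| "good f (e # S) \<longleftrightarrow> good f S \<and> C * load f S e < marg f e (set S)"

primrec total_resid :: "(edge set \<Rightarrow> real) \<Rightarrow> edge list \<Rightarrow> real" where
  "total_resid f [] = 0"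
| "total_resid f (e # S) = total_resid f S + resid f S e"

primrec pass :: "(edge set \<Rightarrow> real) \<Rightarrow> edge list \<Rightarrow> edge list \<Rightarrow> edge list pmf" where
  "pass f [] S = return_pmf S"
| "pass f (e # es) S =
     (if marg f e (set S) \<le> C * load f S e then pass f es S
      else bind_pmf (bernoulli_pmf q) (\<lambda>b. if b then pass f es (e # S) else pass f es S))"

text \<open>The blocked vertices are a parameter so that statements about the unwinding can be
  proved by induction on the stack; the algorithm starts with \<open>U = {}\<close>.\<close>

primrec greedy :: "nat set \<Rightarrow> edge list \<Rightarrow> edge set" where
  "greedy U [] = {}"
| "greedy U (e # S) = (if e \<inter> U = {} then insert e (greedy (U \<union> e) S) else greedy U S)"

lemma phi_nonneg:
  assumes "good f S"
  shows "0 \<le> phi f S v"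
  using assms
proof (induction S arbitrary: v)
  case (Cons e S)
  have l: "0 \<le> load f S e"
    using Cons by (auto simp: load_def intro!: sum_nonneg)
  moreover have "1 * load f S e \<le> C * load f S e"
    using C_gt_1 l by (intro mult_right_mono) auto
  ultimately have "0 \<le> resid f S e"
    using Cons.prems by (auto simp: resid_def)
  then show ?case
    using Cons by (auto simp: phi_Cons)
qed simp

lemma load_nonneg: "good f S \<Longrightarrow> 0 \<le> load f S e"
  by (auto simp: load_def intro!: sum_nonneg phi_nonneg)

lemma resid_ge:
  assumes "good f (e # S)"
  shows "(1 - 1 / C) * marg f e (set S) \<le> resid f S e"
  using assms C_gt_1 by (auto simp: resid_def field_simps)

lemma marg_pos:
  assumes "good f (e # S)"
  shows "0 < marg f e (set S)"
proof -
  have "0 \<le> C * load f S e"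
    using load_nonneg[of f S e] assms C_gt_1 by (intro mult_nonneg_nonneg) auto
  then show ?thesis
    using assms by simp
qed

lemma resid_nonneg:
  assumes "good f (e # S)"
  shows "0 \<le> resid f S e"
proof -
  have "0 \<le> (1 - 1 / C) * marg f e (set S)"
    using marg_pos[OF assms] C_gt_1 by (intro mult_nonneg_nonneg) auto
  then show ?thesis
    using resid_ge[OF assms] by linarith
qed

lemma phi_mono_Cons: "good f (e # S) \<Longrightarrow> phi f S v \<le> phi f (e # S) v"
  using resid_nonneg[of f e S] by (auto simp: phi_Cons)

lemma greedy_subset: "greedy U S \<subseteq> set S"
  by (induction S arbitrary: U) auto

lemma greedy_avoids: "e \<in> greedy U S \<Longrightarrow> e \<inter> U = {}"
  by (induction S arbitrary: U) (auto split: if_splits)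

lemma greedy_disjoint: "disjoint (greedy U S)"
proof (induction S arbitrary: U)
  case (Cons e S)
  have "e \<inter> d = {}" if "d \<in> greedy (U \<union> e) S" for d
    using greedy_avoids[OF that] by auto
  then show ?case
    using Cons by (auto simp: disjoint_def Int_commute)
qed (simp add: disjoint_def)

lemma greedy_maximal: "e \<in> set S \<Longrightarrow> e \<noteq> {} \<Longrightarrow> e \<inter> (U \<union> \<Union> (greedy U S)) \<noteq> {}"
proof (induction S arbitrary: U)
  case (Cons x S)
  then show ?case
    using Cons.IH[of U] Cons.IH[of "U \<union> x"]
    by (cases "x \<inter> U = {}"; cases "e = x") (auto simp: Un_assoc)
qed simp

lemma finite_set_pmf_pass [simp]: "finite (set_pmf (pass f es S))"
  by (induction es arbitrary: S) auto

lemma pass_extends: "L \<in> set_pmf (pass f es S) \<Longrightarrow> \<exists>K. L = K @ S \<and> set K \<subseteq> set es"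
proof (induction es arbitrary: S)
  case (Cons e es)
  have "\<exists>S'\<in>{S, e # S}. L \<in> set_pmf (pass f es S')"
    using Cons.prems by (auto split: if_splits)
  then obtain S' where S': "S' \<in> {S, e # S}" "L \<in> set_pmf (pass f es S')" by blast
  then obtain K where "L = K @ S'" "set K \<subseteq> set es"
    using Cons.IH by blast
  then show ?case using S'(1) by (auto intro: exI[of _ "K @ [e]"])
qed simp

lemma pass_good: "L \<in> set_pmf (pass f es S) \<Longrightarrow> good f S \<Longrightarrow> good f L"
  by (induction es arbitrary: S) (auto split: if_splits)

lemma pass_distinct:
  "L \<in> set_pmf (pass f es S) \<Longrightarrow> distinct es \<Longrightarrow> distinct S \<Longrightarrow> set es \<inter> set S = {} \<Longrightarrow> distinct L"
proof (induction es arbitrary: S)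
  case (Cons e es)
  then show ?case using Cons.IH[of S] Cons.IH[of "e # S"] by (auto split: if_splits)
qed simp

lemma phi_mono_append: "good f (K @ S) \<Longrightarrow> phi f S v \<le> phi f (K @ S) v"
proof (induction K)
  case (Cons e K)
  then show ?case using phi_mono_Cons[of f e "K @ S" v] by auto
qed simp

lemma load_mono_pass:
  assumes "L \<in> set_pmf (pass f es S)" "good f S"
  shows "load f S e \<le> load f L e"
proof -
  obtain K where "L = K @ S"
    using pass_extends[OF assms(1)] by blast
  then show ?thesis
    using pass_good[OF assms] by (auto simp: load_def intro!: sum_mono phi_mono_append)
qed

section \<open>Expectations over the pass\<close>

abbreviation (input) expect :: "'a pmf \<Rightarrow> ('a \<Rightarrow> real) \<Rightarrow> real" where
  "expect \<equiv> measure_pmf.expectation"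

lemma expect_coin:
  assumes "finite (set_pmf p)" "finite (set_pmf r)"
  shows "expect (bind_pmf (bernoulli_pmf q) (\<lambda>b. if b then p else r)) g =
    q * expect p g + (1 - q) * expect r g"
  using assms q_bounds
  by (subst pmf_expectation_bind[where A = UNIV]) (auto simp: UNIV_bool)

lemma expect_mono:
  assumes "finite (set_pmf p)" "\<And>x. x \<in> set_pmf p \<Longrightarrow> g x \<le> h x"
  shows "expect p g \<le> expect p h"
  using assms by (intro integral_mono_AE integrable_measure_pmf_finite) (auto intro: AE_pmfI)

lemma expect_ge_const:
  assumes "finite (set_pmf p)" "\<And>x. x \<in> set_pmf p \<Longrightarrow> c \<le> h x"
  shows "c \<le> expect p h"
  using expect_mono[OF assms(1), of "\<lambda>_. c" h] assms(2) by simp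

lemma expect_le_const:
  assumes "finite (set_pmf p)" "\<And>x. x \<in> set_pmf p \<Longrightarrow> h x \<le> c"
  shows "expect p h \<le> c"
  using expect_mono[OF assms(1), of h "\<lambda>_. c"] assms(2) by simp

lemma expect_pass_Cons:
  "expect (pass f (e # es) S) g =
     (if marg f e (set S) \<le> C * load f S e then expect (pass f es S) g
      else q * expect (pass f es (e # S)) g + (1 - q) * expect (pass f es S) g)"
  by (simp add: expect_coin)

text \<open>At most one coin is tossed for \<open>e\<close>, because \<open>es\<close> is distinct,
  and none if \<open>e\<close> fails the test; hence only an inequality. The coins of earlier edges
  merely average the bound.\<close>

lemma pass_probability:
  assumes "e \<notin> set S" "distinct es"
  shows "expect (pass f es S) (\<lambda>L. of_bool (e \<in> set L)) \<le> q"
  using assms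
proof (induction es arbitrary: S)
  case Nil
  then show ?case using q_bounds by simp
next
  case (Cons x es)
  show ?case
  proof (cases "x = e")
    case True
    have absent: "expect (pass f es S) (\<lambda>L. of_bool (e \<in> set L)) = 0"
    proof -
      have "e \<notin> set L" if "L \<in> set_pmf (pass f es S)" for L
        using pass_extends[OF that] Cons.prems True by auto
      then have "expect (pass f es S) (\<lambda>L. of_bool (e \<in> set L)) = expect (pass f es S) (\<lambda>_. 0)"
        by (intro integral_cong_AE) (auto intro: AE_pmfI)
      then show ?thesis by simp
    qed
    have "expect (pass f es (x # S)) (\<lambda>L. of_bool (e \<in> set L)) \<le> 1"
      by (rule expect_le_const) auto
    then show ?thesis
      using q_bounds absent unfolding expect_pass_Cons by (auto simp: mult_le_cancel_left1)
  next
    case False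
    have "expect (pass f es (x # S)) (\<lambda>L. of_bool (e \<in> set L)) \<le> q"
      "expect (pass f es S) (\<lambda>L. of_bool (e \<in> set L)) \<le> q"
      using Cons False by auto
    moreover from this have "q * expect (pass f es (x # S)) (\<lambda>L. of_bool (e \<in> set L)) +
        (1 - q) * expect (pass f es S) (\<lambda>L. of_bool (e \<in> set L)) \<le> q * q + (1 - q) * q"
      using q_bounds by (intro add_mono mult_left_mono) auto
    ultimately show ?thesis
      unfolding expect_pass_Cons by (auto simp: algebra_simps)
  qed
qed

section \<open>Deterministic bounds and the charging argument\<close>

locale msm =
  fixes V :: "nat set" and E :: "edge set" and f :: "edge set \<Rightarrow> real"
  assumes inst: "msm_instance V E f"
begin

lemma finite_V: "finite V"
  and edge_subset: "e \<in> E \<Longrightarrow> e \<subseteq> V"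
  and card_edge: "e \<in> E \<Longrightarrow> card e = 2"
  and f_nonneg: "X \<subseteq> E \<Longrightarrow> 0 \<le> f X"
  using inst by (auto simp: msm_instance_def simple_graph_def nonneg_on_def)

lemma finite_E: "finite E"
  using finite_V edge_subset by (intro finite_subset[of E "Pow V"]) auto

lemma finite_edge: "e \<in> E \<Longrightarrow> finite e"
  using edge_subset finite_V finite_subset by blast

lemma marg_antimono:
  "X \<subseteq> Y \<Longrightarrow> Y \<subseteq> E \<Longrightarrow> e \<in> E \<Longrightarrow> e \<notin> Y \<Longrightarrow> marg f e Y \<le> marg f e X"
  using inst by (simp add: msm_instance_def submodular_on_def marg_def)

text \<open>Every push adds its residual at exactly two vertices.\<close>

lemma sum_phi: "set S \<subseteq> E \<Longrightarrow> (\<Sum>v\<in>V. phi f S v) = 2 * total_resid f S"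
proof (induction S)
  case (Cons e S)
  then have "V \<inter> e = e"
    using edge_subset by auto
  then show ?case
    using Cons finite_V card_edge[of e]
    by (simp add: phi_Cons sum.distrib sum.If_cases algebra_simps Int_def[symmetric])
qed simp

text \<open>The marginals of the pushes telescope, and each is at most \<open>C / (C - 1)\<close>
  times its residual by \<open>resid_ge\<close>.\<close>

lemma f_stack_le:
  assumes "good f S"
  shows "f (set S) \<le> f {} + C / (C - 1) * total_resid f S"
  using assms
proof (induction S)
  case (Cons e S)
  have "marg f e (set S) \<le> C / (C - 1) * resid f S e"
    using resid_ge[OF Cons.prems] C_gt_1 by (simp add: field_simps)
  then show ?case
    using Cons by (simp add: marg_def algebra_simps)
qed simp

text \<open>An edge of the stack that meets \<open>U\<close> contributes its residual to some \<open>phi f S v\<close> with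
  \<open>v \<in> U\<close>; an edge that is chosen pays with its marginal also for the potentials of its
  endpoints.\<close>

lemma f_greedy_ge:
  assumes "good f S" "distinct S" "set S \<subseteq> E" "finite U"
  shows "f {} + total_resid f S - (\<Sum>v\<in>U. phi f S v) \<le> f (greedy U S)"
  using assms
proof (induction S arbitrary: U)
  case (Cons e S)
  have e: "e \<in> E" "finite e"
    using Cons.prems finite_edge by auto
  show ?case
  proof (cases "e \<inter> U = {}")
    case True
    let ?G = "greedy (U \<union> e) S"
    have "marg f e (set S) \<le> marg f e ?G"
      using Cons.prems greedy_subset by (intro marg_antimono) auto
    moreover have "f {} + total_resid f S - (\<Sum>v\<in>U \<union> e. phi f S v) \<le> f ?G"
      using Cons e by auto
    moreover have "(\<Sum>v\<in>U \<union> e. phi f S v) = (\<Sum>v\<in>U. phi f S v) + load f S e"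
      using True e Cons.prems by (subst sum.union_disjoint) (auto simp: load_def)
    moreover have "(\<Sum>v\<in>U. phi f (e # S) v) = (\<Sum>v\<in>U. phi f S v)"
      using True by (intro sum.cong) (auto simp: phi_Cons)
    ultimately show ?thesis
      using True by (simp add: marg_def resid_def)
  next
    case False
    then obtain u where u: "u \<in> e" "u \<in> U" by auto
    have r: "0 \<le> resid f S e"
      using Cons.prems(1) by (rule resid_nonneg)
    have "(\<Sum>v\<in>U. phi f S v) + resid f S e = (\<Sum>v\<in>U. phi f S v + (if v = u then resid f S e else 0))"
      using u Cons.prems(4) by (simp add: sum.distrib)
    also have "\<dots> \<le> (\<Sum>v\<in>U. phi f (e # S) v)"
      using u r by (intro sum_mono) (auto simp: phi_Cons)
    finally show ?thesis
      using Cons.IH[of U] Cons.prems False by simp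
  qed
qed simp

lemma f_union_le:
  assumes "X \<subseteq> E" "Y \<subseteq> E"
  shows "f (X \<union> Y) \<le> f X + (\<Sum>e\<in>Y. marg f e X)"
proof -
  have "finite Y"
    using assms finite_E finite_subset by blast
  then show ?thesis
    using assms
  proof (induction Y)
    case (insert e Y)
    have "marg f e (X \<union> Y) \<le> marg f e X"
      using insert by (cases "e \<in> X") (auto intro: marg_antimono)
    then show ?case
      using insert by (simp add: marg_def)
  qed simp
qed

text \<open>Until \<open>e\<close> arrives, both sides are averaged over the same coins. Let it
  arrive with marginal \<open>m\<close> and load \<open>l\<close>. A failed test gives
  \<open>m \<le> C * l\<close>, and afterwards the marginal can only fall and the load only grow.
  After a successful test, a push makes the marginal 0 and the load at least
  \<open>2 * m - l\<close>, while a lost coin leaves a marginal of at most \<open>m\<close>. The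
  bias of the coin balances the two outcomes.\<close>

lemma expect_marg_le:
  assumes "good f S" "distinct es" "set es \<inter> set S = {}" "set es \<union> set S \<subseteq> E" "e \<in> set es"
  shows "expect (pass f es S) (\<lambda>L. marg f e (set L)) \<le> C * expect (pass f es S) (\<lambda>L. load f L e)"
  using assms
proof (induction es arbitrary: S)
  case (Cons x es)
  let ?m = "marg f x (set S)" and ?l = "load f S x"
  show ?case
  proof (cases "x = e")
    case False
    have 1: "expect (pass f es S) (\<lambda>L. marg f e (set L)) \<le> C * expect (pass f es S) (\<lambda>L. load f L e)"
      using Cons False by auto
    show ?thesis
    proof (cases "?m \<le> C * ?l")
      case False
      have 2: "expect (pass f es (x # S)) (\<lambda>L. marg f e (set L))
          \<le> C * expect (pass f es (x # S)) (\<lambda>L. load f L e)"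
        using Cons \<open>x \<noteq> e\<close> False by auto
      have "q * expect (pass f es (x # S)) (\<lambda>L. marg f e (set L)) +
          (1 - q) * expect (pass f es S) (\<lambda>L. marg f e (set L))
        \<le> q * (C * expect (pass f es (x # S)) (\<lambda>L. load f L e)) +
          (1 - q) * (C * expect (pass f es S) (\<lambda>L. load f L e))"
        using 1 2 q_bounds by (intro add_mono mult_left_mono) auto
      then show ?thesis
        using False unfolding expect_pass_Cons by (simp add: algebra_simps)
    qed (use 1 in \<open>simp only: expect_pass_Cons if_True\<close>)
  next
    case True
    have m: "expect (pass f es S) (\<lambda>L. marg f e (set L)) \<le> ?m"
    proof (rule expect_le_const)
      fix L assume "L \<in> set_pmf (pass f es S)"
      then obtain K where "L = K @ S" "set K \<subseteq> set es"
        using pass_extends by blast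
      then show "marg f e (set L) \<le> ?m"
        using Cons.prems True by (auto intro!: marg_antimono)
    qed simp
    have l: "?l \<le> expect (pass f es S) (\<lambda>L. load f L e)"
      using load_mono_pass Cons.prems(1) True by (intro expect_ge_const) auto
    show ?thesis
    proof (cases "?m \<le> C * ?l")
      case pass: True
      have "C * ?l \<le> C * expect (pass f es S) (\<lambda>L. load f L e)"
        using l C_gt_1 by simp
      then show ?thesis
        using m pass unfolding expect_pass_Cons by simp
    next
      case False
      have "expect (pass f es (x # S)) (\<lambda>L. marg f e (set L)) \<le> 0"
      proof (rule expect_le_const)
        fix L assume "L \<in> set_pmf (pass f es (x # S))"
        then show "marg f e (set L) \<le> 0"
          using pass_extends[of L f es "x # S"] True by auto
      qed simp
      then have lhs: "q * expect (pass f es (x # S)) (\<lambda>L. marg f e (set L)) +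
          (1 - q) * expect (pass f es S) (\<lambda>L. marg f e (set L)) \<le> q * 0 + (1 - q) * ?m"
        using m q_bounds by (intro add_mono mult_left_mono) auto
      have "load f (x # S) e \<le> expect (pass f es (x # S)) (\<lambda>L. load f L e)"
        using load_mono_pass[of _ f es "x # S"] Cons.prems(1) False
        by (intro expect_ge_const) auto
      \<comment> \<open>Both endpoints receive the residual \<open>?m - ?l\<close>, so the load
        rises by twice that amount.\<close>
      moreover have "load f (x # S) e = 2 * ?m - ?l"
        using True card_edge[of x] Cons.prems
        by (simp add: load_def phi_Cons sum.distrib resid_def)
      ultimately have "q * (2 * ?m - ?l) + (1 - q) * ?l
          \<le> q * expect (pass f es (x # S)) (\<lambda>L. load f L e) +
            (1 - q) * expect (pass f es S) (\<lambda>L. load f L e)"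
        using l q_bounds by (intro add_mono mult_left_mono) auto
      then have "C * (q * (2 * ?m - ?l) + (1 - q) * ?l)
          \<le> C * (q * expect (pass f es (x # S)) (\<lambda>L. load f L e) +
            (1 - q) * expect (pass f es S) (\<lambda>L. load f L e))"
        using C_gt_1 by (intro mult_left_mono) auto
      \<comment> \<open>By \<open>coin_balance\<close> the first summand is the bound
        \<open>(1 - q) * ?m\<close> of the left side; the second is nonnegative since
        \<open>q < 1 / 2\<close>.\<close>
      moreover have "C * (q * (2 * ?m - ?l) + (1 - q) * ?l) = 2 * q * C * ?m + C * (1 - 2 * q) * ?l"
        by (simp add: algebra_simps)
      moreover have "0 \<le> C * (1 - 2 * q) * ?l"
        using load_nonneg[OF Cons.prems(1)] C_gt_1 q_bounds by (intro mult_nonneg_nonneg) auto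
      ultimately show ?thesis
        using lhs False unfolding expect_pass_Cons coin_balance by simp
    qed
  qed
qed simp

end

text \<open>The sets are compared with the chain of prefixes of the elements in the order of decreasing
  probability; summation by parts leaves only nonnegative terms besides the first.\<close>

lemma expect_sampled_ge:
  fixes p :: "'a pmf" and X :: "'a \<Rightarrow> edge set"
  assumes sub: "submodular_on E g" and nn: "nonneg_on E g" and fin: "finite E"
    and finp: "finite (set_pmf p)" and X: "\<And>x. x \<in> set_pmf p \<Longrightarrow> X x \<subseteq> E"
    and prob: "\<And>e. e \<in> E \<Longrightarrow> expect p (\<lambda>x. of_bool (e \<in> X x)) \<le> r" and r: "0 \<le> r"
  shows "(1 - r) * g {} \<le> expect p (\<lambda>x. g (X x))"
proof -
  define P where "P e = expect p (\<lambda>x. of_bool (e \<in> X x))" for e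
  have P_nonneg: "0 \<le> P e" for e
    unfolding P_def by (rule expect_ge_const) (auto simp: finp)
  have int: "integrable (measure_pmf p) h" for h :: "'a \<Rightarrow> real"
    using finp by (rule integrable_measure_pmf_finite)
  \<comment> \<open>The term with \<open>s\<close> carries the summation by parts. The head
    \<open>e\<close> has the least probability, so the induction hypothesis applies to the tail with
    \<open>s\<close> replaced by \<open>P e\<close>; the resulting \<open>P e * ?B\<close> cancels
    against the marginal term and leaves \<open>P e * ?A\<close>, which is at least
    \<open>s * ?A\<close>.\<close>
  have claim: "(1 - r) * g {} + s * g (set xs) \<le> expect p (\<lambda>x. g (X x \<inter> set xs))"
    if "distinct xs" "set xs \<subseteq> E" "sorted (map P xs)" "s \<le> r" "\<And>e. e \<in> set xs \<Longrightarrow> s \<le> P e" for xs s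
    using that
  proof (induction xs arbitrary: s)
    case Nil
    have "s * g {} \<le> r * g {}"
      using Nil nn by (intro mult_right_mono) (auto simp: nonneg_on_def)
    then show ?case
      by (simp add: algebra_simps)
  next
    case (Cons e xs)
    let ?A = "g (set (e # xs))" and ?B = "g (set xs)"
    have "g (X x \<inter> set xs) + of_bool (e \<in> X x) * (?A - ?B) \<le> g (X x \<inter> set (e # xs))"
      if "x \<in> set_pmf p" for x
    proof (cases "e \<in> X x")
      case True
      then have "X x \<inter> set (e # xs) = X x \<inter> set xs \<union> {e}"
        by auto
      moreover have "g (set xs \<union> {e}) - ?B \<le> g (X x \<inter> set xs \<union> {e}) - g (X x \<inter> set xs)"
        using sub Cons.prems(1,2) unfolding submodular_on_def by auto
      ultimately show ?thesis
        using True by simp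
    qed simp
    then have "expect p (\<lambda>x. g (X x \<inter> set xs) + of_bool (e \<in> X x) * (?A - ?B))
        \<le> expect p (\<lambda>x. g (X x \<inter> set (e # xs)))"
      by (intro expect_mono finp)
    moreover have "expect p (\<lambda>x. g (X x \<inter> set xs) + of_bool (e \<in> X x) * (?A - ?B))
        = expect p (\<lambda>x. g (X x \<inter> set xs)) + P e * (?A - ?B)"
      unfolding P_def by (subst Bochner_Integration.integral_add) (auto intro: int)
    moreover have "(1 - r) * g {} + P e * ?B \<le> expect p (\<lambda>x. g (X x \<inter> set xs))"
      using Cons.prems prob[of e] by (intro Cons.IH) (auto simp: P_def)
    moreover have "s * ?A \<le> P e * ?A"
      using Cons.prems nn by (intro mult_right_mono) (auto simp: nonneg_on_def)
    ultimately show ?case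
      by (simp add: algebra_simps)
  qed
  obtain ys where ys: "set ys = E" "distinct ys"
    using finite_distinct_list[OF fin] by blast
  have "(1 - r) * g {} + 0 * g (set (sort_key P ys)) \<le> expect p (\<lambda>x. g (X x \<inter> set (sort_key P ys)))"
    using ys r P_nonneg by (intro claim) auto
  also have "\<dots> = expect p (\<lambda>x. g (X x))"
    using X ys by (intro integral_cong_AE) (auto intro!: AE_pmfI simp: Int_absorb2)
  finally show ?thesis by simp
qed

definition deg :: "edge list \<Rightarrow> nat \<Rightarrow> nat" where
  "deg S v = length (filter (\<lambda>e. v \<in> e) S)"

section \<open>The approximation ratio\<close>

context msm
begin

text \<open>The edges of a matching share no endpoint, so no potential is counted twice.\<close>

lemma matching_sum_load_le:
  assumes "good f S" "matching E M"
  shows "(\<Sum>e\<in>M. load f S e) \<le> (\<Sum>v\<in>V. phi f S v)"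
proof -
  have "(\<Sum>e\<in>M. load f S e) = (\<Sum>v\<in>\<Union>M. phi f S v)"
    using assms(2) finite_edge
    by (subst sum.Union_disjoint) (auto simp: matching_def disjoint_def load_def)
  also have "\<dots> \<le> (\<Sum>v\<in>V. phi f S v)"
    using assms edge_subset finite_V by (intro sum_mono2) (auto simp: matching_def phi_nonneg)
  finally show ?thesis .
qed

text \<open>The sampling lemma is applied to the function that sends \<open>X\<close> to
  \<open>f (X \<union> OPT)\<close>. It is again submodular and nonnegative, and its value at
  \<open>{}\<close> is \<open>f OPT\<close>.\<close>

lemma expect_union_ge:
  assumes "distinct es" "set es = E" "OPT \<subseteq> E"
  shows "(1 - q) * f OPT \<le> expect (pass f es []) (\<lambda>L. f (set L \<union> OPT))"
proof -
  have "submodular_on E (\<lambda>X. f (X \<union> OPT))"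
    unfolding submodular_on_def
  proof (intro allI impI)
    fix S T e assume *: "S \<subseteq> T \<and> T \<subseteq> E \<and> e \<in> E \<and> e \<notin> T"
    show "f (T \<union> {e} \<union> OPT) - f (T \<union> OPT) \<le> f (S \<union> {e} \<union> OPT) - f (S \<union> OPT)"
      using marg_antimono[of "S \<union> OPT" "T \<union> OPT" e] * assms(3)
      by (cases "e \<in> OPT") (auto simp: marg_def insert_absorb)
  qed
  moreover have "nonneg_on E (\<lambda>X. f (X \<union> OPT))"
    using f_nonneg assms(3) by (simp add: nonneg_on_def)
  moreover have "set L \<subseteq> E" if "L \<in> set_pmf (pass f es [])" for L
    using pass_extends[OF that] assms by auto
  ultimately have "(1 - q) * f ({} \<union> OPT) \<le> expect (pass f es []) (\<lambda>L. f (set L \<union> OPT))"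
    using assms pass_probability q_bounds
    by (intro expect_sampled_ge[where E = E and g = "\<lambda>X. f (X \<union> OPT)"]) (auto simp: finite_E)
  then show ?thesis by simp
qed

lemma expect_greedy_ge:
  assumes es: "distinct es" "set es = E" and OPT: "matching E OPT"
  shows "1 / (4 + 2 * sqrt 3) * f OPT \<le> expect (pass f es []) (\<lambda>L. f (greedy {} L))"
proof -
  let ?p = "pass f es []" and ?R = "2 * C + C / (C - 1)"
  have int: "integrable (measure_pmf ?p) h" for h :: "_ \<Rightarrow> real"
    by (rule integrable_measure_pmf_finite) simp
  have L: "good f L" "distinct L" "set L \<subseteq> E" if "L \<in> set_pmf ?p" for L
    using pass_good[OF that] pass_distinct[OF that] pass_extends[OF that] es by auto
  have OPT_E: "OPT \<subseteq> E"
    using OPT by (simp add: matching_def)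
  have R: "1 \<le> ?R"
    using C_gt_1 by (simp add: add_increasing2)
  have "(1 - q) * f OPT \<le> expect ?p (\<lambda>L. f (set L \<union> OPT))"
    using es OPT_E by (rule expect_union_ge)
  also have "\<dots> \<le> expect ?p (\<lambda>L. f (set L) + (\<Sum>e\<in>OPT. marg f e (set L)))"
    using L(3) OPT_E by (intro expect_mono f_union_le) auto
  also have "\<dots> = expect ?p (\<lambda>L. f (set L)) + (\<Sum>e\<in>OPT. expect ?p (\<lambda>L. marg f e (set L)))"
    by (simp add: int)
  also have "\<dots> \<le> expect ?p (\<lambda>L. f (set L)) + (\<Sum>e\<in>OPT. C * expect ?p (\<lambda>L. load f L e))"
    using es OPT_E by (intro add_left_mono sum_mono expect_marg_le) auto
  also have "\<dots> = expect ?p (\<lambda>L. f (set L) + C * (\<Sum>e\<in>OPT. load f L e))"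
    by (simp add: int sum_distrib_left)
  \<comment> \<open>This holds on every run: the left side is at most
    \<open>f {} + ?R * total_resid f L\<close>. Since \<open>1 \<le> ?R\<close> and
    \<open>f {}\<close> is nonnegative, \<open>?R\<close> can be factored out, and the greedy bound
    with \<open>U = {}\<close> applies.\<close>
  also have "\<dots> \<le> expect ?p (\<lambda>L. ?R * f (greedy {} L))"
  proof (rule expect_mono)
    fix L assume "L \<in> set_pmf ?p"
    note L = L[OF this]
    have "C * (\<Sum>e\<in>OPT. load f L e) \<le> C * (2 * total_resid f L)"
      using matching_sum_load_le[OF L(1) OPT] sum_phi[OF L(3)] C_gt_1 by simp
    moreover have "f (set L) \<le> f {} + C / (C - 1) * total_resid f L"
      using L(1) by (rule f_stack_le)
    moreover have "1 * f {} \<le> ?R * f {}"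
      using R f_nonneg[of "{}"] by (intro mult_right_mono) auto
    moreover have "?R * (f {} + total_resid f L) \<le> ?R * f (greedy {} L)"
      using f_greedy_ge[OF L, of "{}"] R by (intro mult_left_mono) auto
    ultimately show "f (set L) + C * (\<Sum>e\<in>OPT. load f L e) \<le> ?R * f (greedy {} L)"
      by (simp add: algebra_simps)
  qed simp
  also have "\<dots> = (1 - q) * ((4 + 2 * sqrt 3) * expect ?p (\<lambda>L. f (greedy {} L)))"
    unfolding ratio_identity by simp
  finally have "f OPT \<le> (4 + 2 * sqrt 3) * expect ?p (\<lambda>L. f (greedy {} L))"
    using q_bounds by simp
  moreover have "0 < 4 + 2 * sqrt (3::real)"
    by (simp add: add_pos_nonneg)
  ultimately show ?thesis
    by (simp add: field_simps)
qed

lemma matching_greedy: "set S \<subseteq> E \<Longrightarrow> matching E (greedy U S)"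
  using greedy_subset[of U S] greedy_disjoint by (auto simp: matching_def)

lemma card_matching_le: "matching E M \<Longrightarrow> card M \<le> M_max E"
proof -
  assume "matching E M"
  moreover have "finite {M. matching E M}"
    by (rule finite_subset[of _ "Pow E"]) (auto simp: matching_def finite_E)
  ultimately show ?thesis
    unfolding M_max_def by (intro Max_ge) auto
qed

section \<open>Logarithmic degree and the length of the stack\<close>

lemma phi_le_load:
  assumes "good f S" "e \<in> E" "v \<in> e"
  shows "phi f S v \<le> load f S e"
  unfolding load_def using assms finite_edge by (intro member_le_sum) (auto simp: phi_nonneg)

text \<open>A push at \<open>v\<close> first adds the marginal and then subtracts a load that is at
  least the old potential of \<open>v\<close>. The new potential is therefore at most the marginal,
  which submodularity bounds by \<open>f {e} - f {}\<close>.\<close>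

lemma phi_le:
  assumes "\<And>e. e \<in> E \<Longrightarrow> f {e} \<le> F" "0 \<le> F" "good f S" "distinct S" "set S \<subseteq> E"
  shows "phi f S v \<le> F"
  using assms(3-)
proof (induction S)
  case Nil
  then show ?case using assms by simp
next
  case (Cons e S)
  have "marg f e (set S) \<le> marg f e {}"
    using Cons.prems by (intro marg_antimono) auto
  also have "\<dots> \<le> F"
    using assms(1)[of e] f_nonneg[of "{}"] Cons.prems by (simp add: marg_def)
  finally show ?case
    using phi_le_load[of S e v] Cons by (auto simp: phi_Cons resid_def)
qed

text \<open>The first push at \<open>v\<close> leaves a residual of at least
  \<open>(1 - 1 / C) * \<mu>\<close>. Each later one has marginal above \<open>C\<close> times the
  load, so it adds more than \<open>(C - 1)\<close> times the load, hence at least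
  \<open>(C - 1)\<close> times the old potential.\<close>

lemma phi_ge:
  assumes "0 \<le> \<mu>" "\<And>e X. e \<in> E \<Longrightarrow> X \<subseteq> E \<Longrightarrow> 0 < marg f e X \<Longrightarrow> \<mu> \<le> marg f e X"
    and "good f S" "set S \<subseteq> E" "deg S v = Suc k"
  shows "(1 - 1 / C) * \<mu> * C ^ k \<le> phi f S v"
  using assms(3-)
proof (induction S arbitrary: k)
  case Nil
  then show ?case by (simp add: deg_def)
next
  case (Cons e S)
  show ?case
  proof (cases "v \<in> e")
    case False
    then show ?thesis using Cons by (simp add: deg_def phi_Cons)
  next
    case True
    show ?thesis
    proof (cases k)
      case 0
      have "(1 - 1 / C) * \<mu> \<le> (1 - 1 / C) * marg f e (set S)"
        using assms(2)[of e "set S"] marg_pos[OF Cons.prems(1)] Cons.prems C_gt_1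
        by (intro mult_left_mono) auto
      then show ?thesis
        using resid_ge[OF Cons.prems(1)] phi_nonneg[of f S v] Cons.prems(1) True 0
        by (simp add: phi_Cons)
    next
      case (Suc j)
      have IH: "(1 - 1 / C) * \<mu> * C ^ j \<le> phi f S v"
        using Cons True Suc by (auto simp: deg_def)
      have "(C - 1) * phi f S v \<le> (C - 1) * load f S e"
        using phi_le_load[of S e v] Cons.prems True C_gt_1 by (intro mult_left_mono) auto
      then have "C * phi f S v \<le> phi f (e # S) v"
        using Cons.prems True by (simp add: phi_Cons resid_def algebra_simps)
      moreover have "C * ((1 - 1 / C) * \<mu> * C ^ j) \<le> C * phi f S v"
        using IH C_gt_1 by (intro mult_left_mono) auto
      ultimately show ?thesis
        using Suc by (simp add: mult_ac)
    qed
  qed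
qed

lemma finite_positive_marginals: "finite (positive_marginals E f)"
proof (rule finite_subset)
  show "positive_marginals E f \<subseteq> (\<lambda>(e, X). f (X \<union> {e}) - f X) ` (E \<times> Pow E)"
    by (auto simp: positive_marginals_def)
qed (simp add: finite_E)

lemma deg_power_le:
  assumes "ratio_bounded d V E f" "good f S" "distinct S" "set S \<subseteq> E" "deg S v = Suc k"
  shows "(1 - 1 / C) * C ^ k \<le> real (card V) ^ d"
proof -
  obtain e S' where S: "S = e # S'"
    using assms(5) by (cases S) (auto simp: deg_def)
  have pm: "marg f x X \<in> positive_marginals E f" if "x \<in> E" "X \<subseteq> E" "0 < marg f x X" for x X
    using that by (auto simp: positive_marginals_def marg_def)
  \<comment> \<open>The marginal of the topmost edge discharges the guard in
    \<open>ratio_bounded\<close> and makes \<open>f_min\<close> a genuine positive marginal.\<close>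
  have mem: "marg f e (set S') \<in> positive_marginals E f"
    using assms S marg_pos[of f e S'] by (intro pm) auto
  define F where "F = f_max E f"
  define \<mu> where "\<mu> = f_min E f"
  have "\<mu> \<in> positive_marginals E f"
    unfolding \<mu>_def f_min_def using mem finite_positive_marginals by (intro Min_in) auto
  then have \<mu>: "0 < \<mu>"
    by (simp add: positive_marginals_def)
  have \<mu>_le: "\<mu> \<le> marg f x X" if "x \<in> E" "X \<subseteq> E" "0 < marg f x X" for x X
    unfolding \<mu>_def f_min_def using pm[OF that] finite_positive_marginals by (intro Min_le)
  have F: "f {x} \<le> F" if "x \<in> E" for x
    unfolding F_def f_max_def using that finite_E by (intro Max_ge) auto
  have "0 \<le> F"
    using F[of e] f_nonneg[of "{e}"] S assms by force
  then have "(1 - 1 / C) * \<mu> * C ^ k \<le> F"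
    using phi_ge[of \<mu> S v k] phi_le[of F S v] \<mu> \<mu>_le F assms by force
  then have "(1 - 1 / C) * C ^ k \<le> F / \<mu>"
    using \<mu> by (simp add: field_simps)
  also have "\<dots> \<le> real (card V) ^ d"
    using assms(1) mem unfolding ratio_bounded_def F_def \<mu>_def by auto
  finally show ?thesis .
qed

end

text \<open>Solving \<open>(1 - 1 / C) * C ^ k \<le> n ^ d\<close> for \<open>k + 1\<close> gives
  the two fractions. The factor 2 absorbs the additive constant into the logarithm, as
  \<open>1 \<le> 2 * ln (n + 2)\<close>; the shift by 2 keeps this true for small
  \<open>n\<close>.\<close>

definition deg_const :: "nat \<Rightarrow> real" where
  "deg_const d = 2 * (1 + ln (C / (C - 1)) / ln C) + real d / ln C"

lemma ln_C_pos: "0 < ln C" "0 < ln (C / (C - 1))"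
  using C_gt_1 by (auto simp: field_simps)

lemma ln_nat_ge: "1 / 2 \<le> ln (real n + 2)"
proof -
  have "1 / 2 \<le> ln (2::real)"
    using ln2_ge_two_thirds by simp
  also have "\<dots> \<le> ln (real n + 2)"
    by simp
  finally show ?thesis .
qed

lemma deg_const_nonneg: "0 \<le> deg_const d"
  using ln_C_pos by (simp add: deg_const_def)

context msm
begin

lemma deg_le:
  assumes "ratio_bounded d V E f" "good f S" "distinct S" "set S \<subseteq> E"
  shows "real (deg S v) \<le> deg_const d * ln (real (card V) + 2)"
proof (cases "deg S v")
  case 0
  then show ?thesis using deg_const_nonneg ln_nat_ge[of "card V"] by simp
next
  case (Suc k)
  let ?n = "real (card V)" and ?a = "ln (C / (C - 1)) / ln C"
  have "C ^ k \<le> C / (C - 1) * ?n ^ d"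
    using deg_power_le[OF assms Suc] C_gt_1 by (simp add: field_simps)
  also have "\<dots> \<le> C / (C - 1) * (?n + 2) ^ d"
    using C_gt_1 by (intro mult_left_mono power_mono) auto
  finally have "ln (C ^ k) \<le> ln (C / (C - 1) * (?n + 2) ^ d)"
    using C_gt_1 by (subst ln_le_cancel_iff) auto
  also have "\<dots> = ln (C / (C - 1)) + real d * ln (?n + 2)"
    using C_gt_1 by (subst ln_mult_pos) (auto simp: ln_realpow)
  finally have "real k * ln C \<le> ln (C / (C - 1)) + real d * ln (?n + 2)"
    using C_gt_1 by (simp add: ln_realpow)
  then have "real k \<le> ?a + real d / ln C * ln (?n + 2)"
    using ln_C_pos by (simp add: field_simps)
  moreover have "(1 + ?a) * 1 \<le> (1 + ?a) * (2 * ln (?n + 2))"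
    using ln_nat_ge[of "card V"] ln_C_pos by (intro mult_left_mono) auto
  ultimately show ?thesis
    using Suc by (simp add: deg_const_def algebra_simps)
qed

lemma card_Union_edges: "set S \<subseteq> E \<Longrightarrow> card (\<Union> (set S)) \<le> 2 * length S"
proof (induction S)
  case (Cons e S)
  then show ?case
    using card_Un_le[of e "\<Union> (set S)"] card_edge[of e] by simp
qed simp

text \<open>By maximality, every edge of the stack meets one of the at most
  \<open>2 * M_max E\<close> vertices covered by the greedy matching, and each of these has
  logarithmic degree.\<close>

lemma stack_length_le:
  assumes "ratio_bounded d V E f" "good f S" "distinct S" "set S \<subseteq> E"
  shows "real (length S) \<le> 2 * real (M_max E) * (deg_const d * ln (real (card V) + 2))"
proof -
  let ?M = "greedy {} S" and ?\<Delta> = "deg_const d * ln (real (card V) + 2)"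
  let ?A = "\<Union> ?M"
  have M: "?M \<subseteq> E" "finite ?M"
    using greedy_subset[of "{}" S] assms finite_subset by auto
  then have A: "finite ?A" "card ?A \<le> 2 * card ?M"
    using finite_edge card_edge card_Union_le_sum_card[of ?M] by (auto simp: subset_iff)
  have "set S \<subseteq> (\<Union>v\<in>?A. set (filter (\<lambda>e. v \<in> e) S))"
  proof
    fix e assume e: "e \<in> set S"
    then have "e \<noteq> {}"
      using assms(4) card_edge by fastforce
    then show "e \<in> (\<Union>v\<in>?A. set (filter (\<lambda>e. v \<in> e) S))"
      using greedy_maximal[OF e, of "{}"] e by auto
  qed
  then have "card (set S) \<le> card (\<Union>v\<in>?A. set (filter (\<lambda>e. v \<in> e) S))"
    using A by (intro card_mono finite_UN_I) auto
  also have "\<dots> \<le> (\<Sum>v\<in>?A. card (set (filter (\<lambda>e. v \<in> e) S)))"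
    using A by (intro card_UN_le)
  also have "\<dots> \<le> (\<Sum>v\<in>?A. deg S v)"
    unfolding deg_def by (intro sum_mono card_length)
  finally have "real (length S) \<le> (\<Sum>v\<in>?A. real (deg S v))"
    using distinct_card[OF assms(3)] by (simp flip: of_nat_sum)
  also have "\<dots> \<le> (\<Sum>v\<in>?A. ?\<Delta>)"
    using deg_le[OF assms] by (intro sum_mono)
  also have "\<dots> = real (card ?A) * ?\<Delta>"
    by simp
  also have "\<dots> \<le> (2 * real (M_max E)) * ?\<Delta>"
    using A(2) card_matching_le[OF matching_greedy[OF assms(4)], of "{}"] deg_const_nonneg
      ln_nat_ge[of "card V"]
    by (intro mult_right_mono) auto
  finally show ?thesis .
qed

end

section \<open>Implementation as a streaming program\<close>

text \<open>Registers 1 and 2 hold \<open>C\<close> and \<open>q\<close>, dictionary 0 the potentials, and dictionary 1 marks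
  the matched vertices; the stack of the algorithm is stack 1. The numbers in the margin are the
  positions of the jump targets.\<close>

definition prog :: program where
  "prog =
    [LoadInt 1 3,
     Sqrt 1 1,
     LoadInt 2 3,
     Add 2 2 1,
     LoadInt 3 1,
     Div 2 3 2,
     LoadInt 4 2,
     Div 1 1 4,
     Add 1 1 3,
     Read 0 30,          \<comment> \<open>9\<close>
     Query 4 1,
     Push 1 0,
     Query 3 1,
     Sub 3 3 4,
     Get 4 0 0 False,
     Get 5 0 0 True,
     Add 6 4 5,
     Mul 7 1 6,
     JumpLe 3 7 28,
     Flip 7 2,
     LoadInt 8 0,
     JumpLe 7 8 28,
     Sub 3 3 6,
     Add 4 4 3,
     Add 5 5 3,
     Put 0 0 False 4,
     Put 0 0 True 5,
     JumpLe 0 0 9,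
     Pop 1 1 9,          \<comment> \<open>28\<close>
     JumpLe 0 0 9,
     Pop 1 0 42,         \<comment> \<open>30\<close>
     Get 4 1 0 False,
     Get 5 1 0 True,
     Add 4 4 5,
     LoadInt 5 0,
     JumpLe 4 5 37,
     JumpLe 0 0 30,
     Push 0 0,           \<comment> \<open>37\<close>
     LoadInt 4 1,
     Put 1 0 False 4,
     Put 1 0 True 4,
     JumpLe 0 0 30]"

section \<open>Executing the program symbolically\<close>

lemma length_prog: "length prog = 42"
  by (simp add: prog_def)

text \<open>The configuration is spelled out as a record so that the simplifier can run the program
  instruction by instruction.\<close>

lemma step_prog:
  "p < 42 \<Longrightarrow> step prog f \<tau> \<lparr>pc = p, regs = r, eregs = g, dicts = h, stacks = s,
      stream = es, clock = c\<rparr> =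
    exec f (prog ! p) \<lparr>pc = Suc p, regs = r, eregs = g, dicts = h, stacks = s, stream = es,
      clock = c + cost \<tau> (prog ! p)\<rparr>"
  by (simp add: step_def halted_def length_prog Let_def)

lemma prog_nth:
  "prog ! 0 = LoadInt 1 3" "prog ! Suc 0 = Sqrt 1 1" "prog ! 2 = LoadInt 2 3"
  "prog ! 3 = Add 2 2 1" "prog ! 4 = LoadInt 3 1" "prog ! 5 = Div 2 3 2"
  "prog ! 6 = LoadInt 4 2" "prog ! 7 = Div 1 1 4" "prog ! 8 = Add 1 1 3"
  "prog ! 9 = Read 0 30" "prog ! 10 = Query 4 1" "prog ! 11 = Push 1 0"
  "prog ! 12 = Query 3 1" "prog ! 13 = Sub 3 3 4" "prog ! 14 = Get 4 0 0 False"
  "prog ! 15 = Get 5 0 0 True" "prog ! 16 = Add 6 4 5" "prog ! 17 = Mul 7 1 6"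
  "prog ! 18 = JumpLe 3 7 28" "prog ! 19 = Flip 7 2" "prog ! 20 = LoadInt 8 0"
  "prog ! 21 = JumpLe 7 8 28" "prog ! 22 = Sub 3 3 6" "prog ! 23 = Add 4 4 3"
  "prog ! 24 = Add 5 5 3" "prog ! 25 = Put 0 0 False 4" "prog ! 26 = Put 0 0 True 5"
  "prog ! 27 = JumpLe 0 0 9" "prog ! 28 = Pop 1 1 9" "prog ! 29 = JumpLe 0 0 9"
  "prog ! 30 = Pop 1 0 42" "prog ! 31 = Get 4 1 0 False" "prog ! 32 = Get 5 1 0 True"
  "prog ! 33 = Add 4 4 5" "prog ! 34 = LoadInt 5 0" "prog ! 35 = JumpLe 4 5 37"
  "prog ! 36 = JumpLe 0 0 30" "prog ! 37 = Push 0 0" "prog ! 38 = LoadInt 4 1"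
  "prog ! 39 = Put 1 0 False 4" "prog ! 40 = Put 1 0 True 4" "prog ! 41 = JumpLe 0 0 30"
  by (simp_all add: prog_def)

lemmas exec_simps = step_prog prog_nth set_reg_def set_ereg_def set_stack_def set_dict_def
  endpoint_def

text \<open>Unlike \<open>run\<close>, this splits off the first step, which suits symbolic
  execution and induction over the loops; \<open>run_eq_iter\<close> connects the two.\<close>

primrec iter :: "program \<Rightarrow> (edge set \<Rightarrow> real) \<Rightarrow> nat \<Rightarrow> nat \<Rightarrow> config \<Rightarrow> config pmf" where
  "iter P f \<tau> 0 \<sigma> = return_pmf \<sigma>"
| "iter P f \<tau> (Suc n) \<sigma> = bind_pmf (step P f \<tau> \<sigma>) (iter P f \<tau> n)"

lemma iter_add: "iter P f \<tau> (m + n) \<sigma> = bind_pmf (iter P f \<tau> m \<sigma>) (iter P f \<tau> n)"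
proof (induction m arbitrary: \<sigma>)
  case (Suc m)
  then have "iter P f \<tau> (m + n) = (\<lambda>\<sigma>. bind_pmf (iter P f \<tau> m \<sigma>) (iter P f \<tau> n))"
    by blast
  then show ?case
    by (simp add: bind_assoc_pmf)
qed (simp add: bind_return_pmf)

lemma run_eq_iter: "run P f \<tau> es n = iter P f \<tau> n (init_config es)"
proof (induction n)
  case (Suc n)
  have "iter P f \<tau> 0 = return_pmf"
    by (rule ext) simp
  then have "iter P f \<tau> 1 = step P f \<tau>"
    by (intro ext) (simp add: bind_return_pmf')
  then have "iter P f \<tau> (n + 1) (init_config es) = bind_pmf (run P f \<tau> es n) (step P f \<tau>)"
    unfolding iter_add Suc by simp
  then show ?case by simp
qed simp

lemma iter_halted: "halted P \<sigma> \<Longrightarrow> iter P f \<tau> n \<sigma> = return_pmf \<sigma>"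
  by (induction n) (simp_all add: step_def bind_return_pmf)

text \<open>As \<open>1 \<le> \<tau>\<close>, no instruction costs more than a query, so counting
  steps suffices for the running time.\<close>

lemma clock_step:
  assumes "\<sigma>' \<in> set_pmf (step P f \<tau> \<sigma>)" "1 \<le> \<tau>"
  shows "clock \<sigma>' \<le> clock \<sigma> + \<tau>"
proof (cases "halted P \<sigma>")
  case False
  have c: "cost \<tau> i \<le> \<tau>" for i
    using assms(2) by (simp add: cost_def split: instr.splits)
  have "\<sigma>' \<in> set_pmf (exec f i \<rho>) \<Longrightarrow> clock \<sigma>' = clock \<rho>" for i \<rho>
    by (cases i) (auto simp: set_reg_def set_ereg_def set_stack_def set_dict_def
        split: option.splits list.splits if_splits)
  then show ?thesis
    using assms(1) False c by (auto simp: step_def Let_def)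
qed (use assms in \<open>simp add: step_def\<close>)

lemma clock_iter:
  assumes "\<sigma>' \<in> set_pmf (iter P f \<tau> n \<sigma>)" "1 \<le> \<tau>"
  shows "clock \<sigma>' \<le> clock \<sigma> + n * \<tau>"
  using assms
proof (induction n arbitrary: \<sigma>)
  case (Suc n)
  then obtain \<rho> where "\<rho> \<in> set_pmf (step P f \<tau> \<sigma>)" "\<sigma>' \<in> set_pmf (iter P f \<tau> n \<rho>)"
    by auto
  then show ?case
    using Suc clock_step[of \<rho> P f \<tau> \<sigma>] by fastforce
qed simp

text \<open>\<open>B\<close> bounds the stack of the algorithm. Stack 1 may hold one edge more,
  because the arriving edge is pushed provisionally for the second query. The set \<open>A\<close>
  holds the endpoints of the stored edges and of the current one.\<close>

definition safe :: "nat \<Rightarrow> config \<Rightarrow> bool" where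
  "safe B \<sigma> \<longleftrightarrow> (\<forall>k\<ge>9. regs \<sigma> k = 0) \<and> (\<forall>k\<ge>2. eregs \<sigma> k = None) \<and>
     (\<exists>A. finite A \<and> card A \<le> 2 * B + 2 \<and> (\<forall>a v. dicts \<sigma> a v \<noteq> 0 \<longrightarrow> a < 2 \<and> v \<in> A)) \<and>
     (\<forall>k\<ge>2. stacks \<sigma> k = []) \<and> length (stacks \<sigma> 0) \<le> B \<and> length (stacks \<sigma> 1) \<le> B + 1"

lemma safeI:
  assumes "finite A" "card A \<le> 2 * B + 2"
    "\<And>k. 9 \<le> k \<Longrightarrow> r k = 0" "\<And>k. 2 \<le> k \<Longrightarrow> g k = None"
    "\<And>a v. h a v \<noteq> 0 \<Longrightarrow> a < 2 \<and> v \<in> A"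
    "\<And>k. 2 \<le> k \<Longrightarrow> s k = []" "length (s 0) \<le> B" "length (s (Suc 0)) \<le> Suc B"
  shows "safe B \<lparr>pc = p, regs = r, eregs = g, dicts = h, stacks = s, stream = es, clock = c\<rparr>"
  using assms unfolding safe_def by auto

lemma space_used_le:
  assumes "safe B \<sigma>"
  shows "space_used \<sigma> \<le> 6 * B + 16"
proof -
  obtain A where A: "finite A" "card A \<le> 2 * B + 2"
    "\<And>a v. dicts \<sigma> a v \<noteq> 0 \<Longrightarrow> a < 2 \<and> v \<in> A"
    using assms unfolding safe_def by blast
  have low: "\<And>k. 9 \<le> k \<Longrightarrow> regs \<sigma> k = 0" "\<And>k. 2 \<le> k \<Longrightarrow> eregs \<sigma> k = None"
    "\<And>k. 2 \<le> k \<Longrightarrow> stacks \<sigma> k = []"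
    using assms unfolding safe_def by auto
  have "card {k. regs \<sigma> k \<noteq> 0} \<le> card {..<9::nat}"
    using low(1) by (intro card_mono) (auto simp flip: not_le)
  moreover have "card {k. eregs \<sigma> k \<noteq> None} \<le> card {..<2::nat}"
    using low(2) by (intro card_mono) (auto simp flip: not_le)
  ultimately have 1: "card {k. regs \<sigma> k \<noteq> 0} \<le> 9" "card {k. eregs \<sigma> k \<noteq> None} \<le> 2"
    by simp_all
  have "{(a, v). dicts \<sigma> a v \<noteq> 0} \<subseteq> {..<2} \<times> A"
    using A(3) by auto
  then have "card {(a, v). dicts \<sigma> a v \<noteq> 0} \<le> card ({..<2::nat} \<times> A)"
    using A(1) by (intro card_mono) auto
  then have 2: "card {(a, v). dicts \<sigma> a v \<noteq> 0} \<le> 4 * B + 4"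
    using A by (simp add: card_cartesian_product)
  have "(\<Sum>k | stacks \<sigma> k \<noteq> []. length (stacks \<sigma> k)) \<le> (\<Sum>k<2. length (stacks \<sigma> k))"
    using low(3) by (intro sum_mono2) (auto simp flip: not_le)
  also have "\<dots> \<le> 2 * B + 1"
    using assms by (simp add: numeral_2_eq_2 safe_def)
  finally show ?thesis
    using 1 2 unfolding space_used_def by linarith
qed

text \<open>Halting within the budget, the output distribution and the space invariant at all times
  are bundled, so that one symbolic execution proves all three.\<close>

definition outputs :: "nat \<Rightarrow> (edge set \<Rightarrow> real) \<Rightarrow> nat \<Rightarrow> nat \<Rightarrow> config pmf \<Rightarrow> edge set pmf \<Rightarrow> bool" where
  "outputs B f \<tau> K p D \<longleftrightarrow>
     (\<forall>\<sigma>\<in>set_pmf (bind_pmf p (iter prog f \<tau> K)). halted prog \<sigma>) \<and>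
     map_pmf result (bind_pmf p (iter prog f \<tau> K)) = D \<and>
     (\<forall>m. \<forall>\<sigma>\<in>set_pmf (bind_pmf p (iter prog f \<tau> m)). safe B \<sigma>)"

lemma outputs_step:
  assumes "0 < K" "safe B \<sigma>" "outputs B f \<tau> (K - 1) (step prog f \<tau> \<sigma>) D"
  shows "outputs B f \<tau> K (return_pmf \<sigma>) D"
proof -
  obtain k where K: "K = Suc k"
    using assms(1) gr0_implies_Suc by blast
  have "safe B \<sigma>'" if "\<sigma>' \<in> set_pmf (iter prog f \<tau> m \<sigma>)" for m \<sigma>'
    using that assms(2,3) by (cases m) (auto simp: outputs_def)
  then show ?thesis
    using assms(3) by (simp add: outputs_def bind_return_pmf K)
qed

text \<open>The remaining budget is arbitrary because a halted configuration no longer changes;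
  execution paths of different lengths can thus share one budget.\<close>

lemma outputs_halted:
  assumes "halted prog \<sigma>" "safe B \<sigma>" "D = return_pmf (result \<sigma>)"
  shows "outputs B f \<tau> K (return_pmf \<sigma>) D"
  using assms by (simp add: outputs_def bind_return_pmf iter_halted)

lemma outputs_flip:
  assumes "outputs B f \<tau> K (return_pmf (g True)) D1" "outputs B f \<tau> K (return_pmf (g False)) D0"
  shows "outputs B f \<tau> K (map_pmf g (bernoulli_pmf x))
    (bind_pmf (bernoulli_pmf x) (\<lambda>b. if b then D1 else D0))"
proof -
  have g: "outputs B f \<tau> K (return_pmf (g b)) (if b then D1 else D0)" for b
    using assms by simp
  then have "map_pmf result (iter prog f \<tau> K (g b)) = (if b then D1 else D0)" for b
    by (simp add: outputs_def bind_return_pmf)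
  then have "map_pmf result (bind_pmf (map_pmf g (bernoulli_pmf x)) (iter prog f \<tau> K)) =
      bind_pmf (bernoulli_pmf x) (\<lambda>b. if b then D1 else D0)"
    by (simp add: bind_map_pmf map_bind_pmf)
  then show ?thesis
    using g by (simp add: outputs_def bind_return_pmf bind_map_pmf)
qed

section \<open>Correctness of the two loops\<close>

lemma edge_ends:
  assumes "card (e :: nat set) = 2"
  shows "Min e \<noteq> Max e" "e = {Min e, Max e}"
proof -
  obtain x y where "e = {x, y}" "x \<noteq> y"
    using assms by (auto simp: card_2_iff)
  then show "Min e \<noteq> Max e" "e = {Min e, Max e}"
    by (auto simp: min_def max_def)
qed

lemma mem_edge_iff: "card (e :: nat set) = 2 \<Longrightarrow> x \<in> e \<longleftrightarrow> x = Min e \<or> x = Max e"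
  using edge_ends(2)[of e] by (metis insert_iff singletonD)

lemma sum_edge: "card (e :: nat set) = 2 \<Longrightarrow> sum w e = w (Min e) + w (Max e)"
  using edge_ends[of e]
  by (metis finite.intros empty_iff insert_iff sum.insert sum.empty add.right_neutral)

context msm
begin

text \<open>In the symbolic executions below, the step budget is written as a variable plus the number of
  steps on the path, so that the repeated \<open>outputs_step\<close> stops at the loop head.\<close>

lemma outputs_popping:
  assumes "finite A" "card A \<le> 2 * B + 2"
    "\<And>k. 9 \<le> k \<Longrightarrow> r k = 0" "\<And>k. 2 \<le> k \<Longrightarrow> g k = None"
    "\<And>a v. h a v \<noteq> 0 \<Longrightarrow> a < 2 \<and> v \<in> A" "\<Union> (set S) \<subseteq> A" "set S \<subseteq> E"
    "\<And>k. 2 \<le> k \<Longrightarrow> s k = []" "s 0 = M" "s (Suc 0) = S" "length M + length S \<le> B"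
    "\<And>v. h (Suc 0) v = of_bool (v \<in> U)" "11 * length S < K"
  shows "outputs B f \<tau> K (return_pmf \<lparr>pc = 30, regs = r, eregs = g, dicts = h,
      stacks = s, stream = es, clock = c\<rparr>)
    (return_pmf (set M \<union> greedy U S))"
  using assms(3-)
proof (induction S arbitrary: r g h s c M U K)
  case Nil
  note safe = safeI[OF assms(1,2)]
  show ?case
    apply (rule outputs_step)
    subgoal using Nil by simp
    subgoal using Nil.prems by (intro safe) auto
    using Nil.prems apply (simp add: exec_simps)
    apply (rule outputs_halted)
    subgoal by (simp add: halted_def length_prog)
    subgoal by (rule safe) auto
    subgoal by (simp add: result_def)
    done
next
  case (Cons e S)
  note safe = safeI[OF assms(1,2)]
  note ends = edge_ends[OF card_edge[of e]]
  \<comment> \<open>An iteration that keeps the edge takes 11 steps, one that drops it only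
    7.\<close>
  define K' where "K' = K - 11"
  then have K: "K = K' + 11" "11 * length S < K'"
    using Cons.prems(11) by auto
  have e: "e \<in> E" "Min e \<in> A" "Max e \<in> A" "Min e \<noteq> Max e"
    using ends Cons.prems(4,5) by auto
  have UA: "U \<subseteq> A"
    using Cons.prems(3)[of "Suc 0"] Cons.prems(10) by auto
  define D where "D = return_pmf (set M \<union> greedy U (e # S))"
  show ?case
    unfolding K(1) D_def[symmetric]
  proof (cases "e \<inter> U = {}")
    case True
    then have U: "Min e \<notin> U" "Max e \<notin> U"
      using ends e by auto
    have D: "D = return_pmf (set (e # M) \<union> greedy (U \<union> e) S)"
      using True by (simp add: D_def)
    show "outputs B f \<tau> (K' + 11) (return_pmf \<lparr>pc = 30, regs = r, eregs = g, dicts = h, stacks = s,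
        stream = es, clock = c\<rparr>) D"
      apply ((rule outputs_step, simp, rule safe,
          (use Cons.prems(1-9) e in \<open>auto split: if_splits\<close>)[6],
          simp add: exec_simps Cons.prems U e)+)
      unfolding D
      apply (rule Cons.IH)
      apply (use Cons.prems(1-10) K e ends U UA in \<open>auto split: if_splits\<close>)
      done
  next
    case False
    then have U: "\<not> h (Suc 0) (Min e) + h (Suc 0) (Max e) \<le> 0"
      using mem_edge_iff[OF card_edge[OF e(1)]] by (auto simp: Cons.prems(10) of_bool_def)
    define K0 where "K0 = K' + 4"
    have K0: "K' + 11 = K0 + 7"
      by (simp add: K0_def)
    have D: "D = return_pmf (set M \<union> greedy U S)"
      using False by (simp add: D_def)
    show "outputs B f \<tau> (K' + 11) (return_pmf \<lparr>pc = 30, regs = r, eregs = g, dicts = h, stacks = s,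
        stream = es, clock = c\<rparr>) D"
      unfolding K0
      apply ((rule outputs_step, simp, rule safe,
          (use Cons.prems(1-9) e in \<open>auto split: if_splits\<close>)[6],
          simp add: exec_simps Cons.prems(1-9) U e)+)
      unfolding D
      apply (rule Cons.IH)
      apply (use Cons.prems(1-10) K e ends U UA in \<open>auto simp: K0_def split: if_splits\<close>)
      done
  qed
qed

text \<open>An arriving edge is charged 30 steps: at most 19 for its own iteration and, if it is
  pushed, 11 for popping it later. The last 2 are the failing \<open>Read\<close> and the final
  failing \<open>Pop\<close>.\<close>

lemma outputs_stream:
  assumes bound: "\<And>L. good f L \<Longrightarrow> distinct L \<Longrightarrow> set L \<subseteq> E \<Longrightarrow> length L \<le> B"
    and "r (Suc 0) = C" "r 2 = q" "\<And>k. 9 \<le> k \<Longrightarrow> r k = 0" "\<And>k. 2 \<le> k \<Longrightarrow> g k = None"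
    "h 0 = phi f S" "\<And>a. 0 < a \<Longrightarrow> h a = (\<lambda>_. 0)" "s (Suc 0) = S" "\<And>k. k \<noteq> 1 \<Longrightarrow> s k = []"
    "good f S" "distinct S" "distinct es" "set es \<inter> set S = {}" "set es \<union> set S \<subseteq> E"
    "30 * length es + 11 * length S + 2 \<le> K"
  shows "outputs B f \<tau> K (return_pmf \<lparr>pc = 9, regs = r, eregs = g, dicts = h,
      stacks = s, stream = es, clock = c\<rparr>)
    (map_pmf (greedy {}) (pass f es S))"
  using assms(2-)
proof (induction es arbitrary: r g h s c S K)
  case Nil
  let ?A = "\<Union> (set S)"
  have len: "length S \<le> B"
    using Nil.prems by (intro bound) auto
  have A: "finite ?A" "card ?A \<le> 2 * B + 2"
    using finite_edge card_Union_edges[of S] len Nil.prems(13) by auto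
  note safe = safeI[OF A]
  have dict: "a < 2 \<and> v \<in> ?A" if "h a v \<noteq> 0" for a v
    using that phi_supp Nil.prems(5,6) by (cases "a = 0") auto
  show ?case
    apply (rule outputs_step)
    subgoal using Nil.prems by simp
    subgoal using Nil.prems(1-8) len dict by (intro safe) auto
    apply (simp add: exec_simps)
    apply (rule outputs_popping[OF A, where M = "[]" and U = "{}", simplified])
              apply (use Nil.prems len dict in auto)
    done
next
  case (Cons e es)
  let ?A = "\<Union> (set (e # S))" and ?l = "phi f S (Min e) + phi f S (Max e)"
  note ends = edge_ends[OF card_edge[of e]]
  have len: "length S \<le> B"
    using Cons.prems by (intro bound) auto
  have eE: "e \<in> E" "e \<notin> set S"
    using Cons.prems(12,13) by auto
  have A: "finite ?A" "card ?A \<le> 2 * B + 2"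
    using finite_edge card_Union_edges[of "e # S"] len Cons.prems(13) by auto
  note safe = safeI[OF A]
  have dict: "a < 2 \<and> v \<in> ?A" if "h a v \<noteq> 0" for a v
    using that phi_supp Cons.prems(5,6) by (cases "a = 0") auto
  have e: "Min e \<in> ?A" "Max e \<in> ?A" "Min e \<noteq> Max e"
    using ends eE by auto
  \<comment> \<open>The two endpoints are written in separate steps, so the support bound is also
    needed for the half-updated dictionary.\<close>
  have dict1: "a < 2 \<and> v \<in> ?A" if "(h(0 := (phi f S)(Min e := x))) a v \<noteq> 0" for a v x
    using that dict[of a v] Cons.prems(5) e(1) by (auto split: if_splits)
  have dict2: "a < 2 \<and> v \<in> ?A"
    if "(h(0 := (phi f S)(Min e := x, Max e := y))) a v \<noteq> 0" for a v x y
    using that dict1[of x a v] e(2) by (auto split: if_splits)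
  define K' where "K' = K - 19"
  then have K: "K = K' + 19" "30 * length es + 11 * Suc (length S) + 2 \<le> K'"
    using Cons.prems(14) by auto
  have l: "load f S e = ?l"
    using sum_edge[OF card_edge[OF eE(1)]] by (simp add: load_def)
  have test: "marg f e (set S) = f (insert e (set S)) - f (set S)"
    by (simp add: marg_def)
  show ?case
  proof (cases "marg f e (set S) \<le> C * load f S e")
    case True
    define D where "D = map_pmf (greedy {}) (pass f es S)"
    have D: "map_pmf (greedy {}) (pass f (e # es) S) = D"
      using True by (simp add: D_def)
    have le: "f (insert e (set S)) - f (set S) \<le> C * ?l"
      using True l test by simp
    define K0 where "K0 = K' + 7"
    have K0: "K = K0 + 12"
      using K by (simp add: K0_def)
    show ?thesis
      unfolding D K0
      apply ((rule outputs_step, simp, rule safe, (use Cons.prems(3,4) in auto)[2],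
          erule dict dict1 dict2, (use Cons.prems(7,8) len in auto)[3],
          simp add: exec_simps Cons.prems(1-8) le)+)
      unfolding D_def
      apply (rule Cons.IH)
      apply (use Cons.prems K in \<open>auto simp: K0_def\<close>)
      done
  next
    case False
    define D1 where "D1 = map_pmf (greedy {}) (pass f es (e # S))"
    define D0 where "D0 = map_pmf (greedy {}) (pass f es S)"
    have D: "map_pmf (greedy {}) (pass f (e # es) S) =
        bind_pmf (bernoulli_pmf q) (\<lambda>b. if b then D1 else D0)"
      using False by (simp add: D1_def D0_def map_bind_pmf if_distrib cong: if_cong)
    have phi': "phi f (e # S) = (phi f S)
        (Min e := phi f S (Min e) + (f (insert e (set S)) - f (set S) - ?l),
         Max e := phi f S (Max e) + (f (insert e (set S)) - f (set S) - ?l))"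
      by (rule ext) (simp add: phi_Cons resid_def l test mem_edge_iff[OF card_edge[OF eE(1)]])
    have gt: "\<not> f (insert e (set S)) - f (set S) \<le> C * ?l"
      using False l test by simp
    \<comment> \<open>After the coin, the pushing branch needs 8 more steps and the other one only
      4.\<close>
    define K0 where "K0 = K' + 4"
    have K0: "8 + K' = K0 + 4"
      by (simp add: K0_def)
    show ?thesis
      unfolding D K
      apply ((rule outputs_step, simp, rule safe, (use Cons.prems(3,4) in auto)[2],
          erule dict dict1 dict2, (use Cons.prems(7,8) len in auto)[3],
          simp add: exec_simps Cons.prems(1-8) gt)+)
      apply (rule outputs_flip)
       apply ((rule outputs_step, simp, rule safe, (use Cons.prems(3,4) in auto)[2],
          erule dict dict1 dict2, (use Cons.prems(7,8) len in auto)[3],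
          simp add: exec_simps Cons.prems(1-8) e)+)[1]
       apply (unfold D1_def)[1]
       apply (rule Cons.IH)
                     apply (use Cons.prems(1-8) in \<open>simp_all add: phi'\<close>)[8]
             apply (use Cons.prems(9-13) False eE in auto)[5]
       apply (use K(2) in simp)
      unfolding K0
      apply ((rule outputs_step, simp, rule safe, (use Cons.prems(3,4) in auto)[2],
          erule dict dict1 dict2, (use Cons.prems(7,8) len in auto)[3],
          simp add: exec_simps Cons.prems(1-8) e)+)[1]
      unfolding D0_def
      apply (rule Cons.IH)
      apply (use Cons.prems K in \<open>auto simp: K0_def\<close>)
      done
  qed
qed

text \<open>The 9 steps beyond the budget of the stream loop compute \<open>C\<close> and
  \<open>q\<close> from integer constants.\<close>

lemma outputs_init:
  assumes bound: "\<And>L. good f L \<Longrightarrow> distinct L \<Longrightarrow> set L \<subseteq> E \<Longrightarrow> length L \<le> B"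
    and "distinct es" "set es = E"
  shows "outputs B f \<tau> (30 * length es + 11) (return_pmf (init_config es))
    (map_pmf (greedy {}) (pass f es []))"
proof -
  note safe = safeI[where A = "{}"]
  define K where "K = 30 * length es + 2"
  have K: "30 * length es + 11 = K + 9"
    by (simp add: K_def)
  show ?thesis
    unfolding K init_config_def
    apply ((rule outputs_step, simp, rule safe, (auto)[8],
        simp add: exec_simps flip: numeral_2_eq_2)+)
    apply (rule outputs_stream[OF bound])
    using assms(2,3) by (auto simp: C_def q_def K_def)
qed

end

theorem theorem1p2:
  "\<exists>(P :: program) (c :: real). \<forall>d :: nat. \<exists>(c' :: real) (k :: nat).
     \<forall>(V :: nat set) (E :: edge set) (f :: edge set \<Rightarrow> real) (es :: edge list) (\<tau> :: nat).
       msm_instance V E f \<and> ratio_bounded d V E f \<and> distinct es \<and> set es = E \<and> 1 \<le> \<tau> \<longrightarrow>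
       (\<forall>t. \<forall>\<sigma>\<in>set_pmf (run P f \<tau> es t).
          real (space_used \<sigma>) \<le> c' * (real (M_max E) + 1) * ln (real (card V) + 2) ^ k) \<and>
       (\<exists>T. (\<forall>\<sigma>\<in>set_pmf (run P f \<tau> es T).
               halted P \<sigma> \<and>
               real (clock \<sigma>) \<le> c * (real (card E) + 1) * real \<tau> \<and>
               matching E (result \<sigma>)) \<and>
            (\<forall>OPT. is_arg_max f (matching E) OPT \<longrightarrow>
               measure_pmf.expectation (run P f \<tau> es T) (\<lambda>\<sigma>. f (result \<sigma>))
                 \<ge> 1 / (4 + 2 * sqrt 3) * f OPT))"
\<comment> \<open>The program and the time constant 30 serve every \<open>d\<close>. The space
  constant is left open here and is fixed by the final \<open>show\<close>; it depends only on
  \<open>d\<close>.\<close>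
proof (rule exI[of _ prog], rule exI[of _ 30], intro allI, rule exI, rule exI[of _ 1],
    intro allI impI, elim conjE)
  fix d \<tau> :: nat and V E f and es :: "edge list"
  assume inst: "msm_instance V E f" and ratio: "ratio_bounded d V E f"
    and es: "distinct es" "set es = E" and \<tau>: "1 \<le> \<tau>"
  interpret msm V E f
    by standard (rule inst)
  let ?l = "ln (real (card V) + 2)"
  define b where "b = 2 * real (M_max E) * (deg_const d * ?l)"
  define B where "B = nat \<lfloor>b\<rfloor>"
  define T where "T = 30 * length es + 11"
  have l: "1 / 2 \<le> ?l"
    by (rule ln_nat_ge)
  have "0 \<le> b"
    unfolding b_def using deg_const_nonneg[of d] l by (intro mult_nonneg_nonneg) auto
  then have B: "real B \<le> b"
    by (simp add: B_def)
  have bound: "length L \<le> B" if "good f L" "distinct L" "set L \<subseteq> E" for L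
    using stack_length_le[OF ratio that] unfolding B_def b_def by (simp add: le_nat_floor)
  have out: "outputs B f \<tau> T (return_pmf (init_config es)) (map_pmf (greedy {}) (pass f es []))"
    unfolding T_def using bound es by (rule outputs_init)
  then have halted: "halted prog \<sigma>" if "\<sigma> \<in> set_pmf (run prog f \<tau> es T)" for \<sigma>
    using that by (simp add: outputs_def bind_return_pmf run_eq_iter)
  have result: "map_pmf result (run prog f \<tau> es T) = map_pmf (greedy {}) (pass f es [])"
    using out by (simp add: outputs_def bind_return_pmf run_eq_iter)
  have safe: "safe B \<sigma>" if "\<sigma> \<in> set_pmf (run prog f \<tau> es t)" for t \<sigma>
    using that out by (auto simp: outputs_def bind_return_pmf run_eq_iter)
  have "real (space_used \<sigma>) \<le> (12 * deg_const d + 32) * (real (M_max E) + 1) * ?l ^ 1"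
    if "\<sigma> \<in> set_pmf (run prog f \<tau> es t)" for t \<sigma>
  proof -
    have "real (space_used \<sigma>) \<le> 6 * b + 16"
      using space_used_le[OF safe[OF that]] B by linarith
    \<comment> \<open>The constant 16 is absorbed by \<open>32 * ?l\<close>, since \<open>?l\<close>
      is at least \<open>1 / 2\<close>.\<close>
    also have "\<dots> \<le> 12 * deg_const d * (real (M_max E) * ?l) + 32 * ?l"
      using l by (simp add: b_def algebra_simps)
    also have "\<dots> \<le> 12 * deg_const d * ((real (M_max E) + 1) * ?l) + 32 * ((real (M_max E) + 1) * ?l)"
      using l deg_const_nonneg[of d] by (intro add_mono mult_left_mono) (auto simp: algebra_simps)
    finally show ?thesis
      by (simp add: algebra_simps)
  qed
  moreover have "real (clock \<sigma>) \<le> 30 * (real (card E) + 1) * real \<tau>"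
    if "\<sigma> \<in> set_pmf (run prog f \<tau> es T)" for \<sigma>
  proof -
    have "clock \<sigma> \<le> T * \<tau>"
      using clock_iter[OF that[unfolded run_eq_iter] \<tau>] by (simp add: init_config_def)
    also have "\<dots> \<le> 30 * (card E + 1) * \<tau>"
      using distinct_card[OF es(1)] es(2) by (intro mult_right_mono) (auto simp: T_def)
    finally have "real (clock \<sigma>) \<le> real (30 * (card E + 1) * \<tau>)"
      by (rule of_nat_mono)
    then show ?thesis by (simp add: algebra_simps)
  qed
  moreover have "matching E (result \<sigma>)" if "\<sigma> \<in> set_pmf (run prog f \<tau> es T)" for \<sigma>
  proof -
    have "result \<sigma> \<in> set_pmf (map_pmf (greedy {}) (pass f es []))"
      unfolding result[symmetric] using that by auto
    then obtain L where L: "L \<in> set_pmf (pass f es [])" "result \<sigma> = greedy {} L"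
      by auto
    then show ?thesis
      unfolding L(2) using pass_extends[OF L(1)] es(2) by (intro matching_greedy) auto
  qed
  moreover have "1 / (4 + 2 * sqrt 3) * f OPT
      \<le> measure_pmf.expectation (run prog f \<tau> es T) (\<lambda>\<sigma>. f (result \<sigma>))"
    if "is_arg_max f (matching E) OPT" for OPT
  proof -
    have "1 / (4 + 2 * sqrt 3) * f OPT \<le> expect (map_pmf (greedy {}) (pass f es [])) f"
      using expect_greedy_ge[OF es] that by (simp add: is_arg_max_def)
    also have "\<dots> = measure_pmf.expectation (run prog f \<tau> es T) (\<lambda>\<sigma>. f (result \<sigma>))"
      unfolding result[symmetric] by simp
    finally show ?thesis .
  qed
  ultimately show "(\<forall>t. \<forall>\<sigma>\<in>set_pmf (run prog f \<tau> es t).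
        real (space_used \<sigma>) \<le> (12 * deg_const d + 32) * (real (M_max E) + 1) * ?l ^ 1) \<and>
      (\<exists>T. (\<forall>\<sigma>\<in>set_pmf (run prog f \<tau> es T). halted prog \<sigma> \<and>
          real (clock \<sigma>) \<le> 30 * (real (card E) + 1) * real \<tau> \<and> matching E (result \<sigma>)) \<and>
        (\<forall>OPT. is_arg_max f (matching E) OPT \<longrightarrow>
          1 / (4 + 2 * sqrt 3) * f OPT
            \<le> measure_pmf.expectation (run prog f \<tau> es T) (\<lambda>\<sigma>. f (result \<sigma>))))"
    using halted by blast
qed

end
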